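(* Let $\rho$ and $\sigma$ be two states on $\mathcal{H}_{[n]}=\bigotimes_{i=1}^n\mathcal{H}_i$. In the $n$-qubit parallelized SWAP test of $\rho$ and $\sigma$, for every $\mathbf{z}\in\mathbb{Z}_2^n$, with $T=\mathrm{supp}(\mathbf{z})$, the probability $p(\mathbf{z})$ of measuring the bitstring $\mathbf{z}$ on the $n$ ancilla qubits is $$p(\mathbf{z})=\frac{1}{2^n}\sum_{S\subseteq[n]}(-1)^{|S\cap T|}\,\mathrm{Tr}(\rho_S\sigma_S).$$
   Context: $[n]=\{1,\dots,n\}$. $\mathcal{H}_1,\dots,\mathcal{H}_n$ are finite-dimensional complex Hilbert spaces (for this result the local dimensions are arbitrary and need not be equal), and $\mathcal{H}_{[n]}=\bigotimes_{i=1}^n\mathcal{H}_i$. A state on $\mathcal{H}_{[n]}$ is a positive semidefinite operator of trace $1$. For $S\subseteq[n]$, $S^c=[n]\setminus S$ and $\rho_S=\mathrm{Tr}_{S^c}\rho$ is the reduced state (partial trace over the factors in $S^c$); for $S=\emptyset$, $\mathrm{Tr}(\rho_\emptyset\sigma_\emptyset)=1$. For $\mathbf{z}=(z_1,\dots,z_n)\in\mathbb{Z}_2^n$, $\mathrm{supp}(\mathbf{z})=\{i: z_i\neq 0\}$. The $n$-qubit parallelized SWAP test of $\rho$ and $\sigma$ is the following circuit. There are $n$ ancilla qubits $A_1,\dots,A_n$, and registers $B_1,\dots,B_n$ and $C_1,\dots,C_n$ with $B_i\cong C_i\cong\mathcal{H}_i$. The initial state is $(|0\rangle\langle 0|)^{\otimes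 n}\otimes\rho\otimes\sigma$, with $\rho$ on $B_1\cdots B_n$ and $\sigma$ on $C_1\cdots C_n$. Apply a Hadamard gate $H$ to each ancilla $A_i$; then for each $i$ apply the controlled-SWAP gate with control $A_i$ which swaps $B_i$ and $C_i$ when $A_i$ is in state $|1\rangle$ (and acts trivially when $A_i$ is in state $|0\rangle$); then apply $H$ to each ancilla again; finally measure all ancillas in the computational basis. $p(\mathbf{z})$ denotes the probability of obtaining outcome $\mathbf{z}\in\mathbb{Z}_2^n$. *)

theory Defs
  imports "HOL-Analysis.Analysis"
begin

text \<open>
  Each register \<open>r\<close> carries the Hilbert space of dimension \<open>d r\<close> with a fixed orthonormal basis
  labelled by \<open>0, \<dots>, d r - 1\<close>; every finite-dimensional complex Hilbert space is of this form. The
  tensor product over a finite set \<open>R\<close> of registers has the product basis, labelled by the functions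
  in \<open>labels d R\<close>. An operator is given by its matrix entries: \<open>M x y\<close> stands for \<open>\<langle>x|M|y\<rangle>\<close>. Only
  entries with \<open>x\<close> and \<open>y\<close> in \<open>labels d R\<close> are meaningful.
\<close>

type_synonym 'r operator = "('r \<Rightarrow> nat) \<Rightarrow> ('r \<Rightarrow> nat) \<Rightarrow> complex"

definition labels :: "('r \<Rightarrow> nat) \<Rightarrow> 'r set \<Rightarrow> ('r \<Rightarrow> nat) set" where
  "labels d R = (\<Pi>\<^sub>E r\<in>R. {..<d r})"

definition mult_op :: "('r \<Rightarrow> nat) \<Rightarrow> 'r set \<Rightarrow> 'r operator \<Rightarrow> 'r operator \<Rightarrow> 'r operator" where
  "mult_op d R M N = (\<lambda>x y. \<Sum>k\<in>labels d R. M x k * N k y)"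

definition trace_op :: "('r \<Rightarrow> nat) \<Rightarrow> 'r set \<Rightarrow> 'r operator \<Rightarrow> complex" where
  "trace_op d R M = (\<Sum>x\<in>labels d R. M x x)"

definition adjoint_op :: "'r operator \<Rightarrow> 'r operator" where
  "adjoint_op M = (\<lambda>x y. cnj (M y x))"

definition id_op :: "'r operator" where
  "id_op = (\<lambda>x y. if x = y then 1 else 0)"

text \<open>Membership of the quadratic form in \<open>\<real>\<^sub>\<ge>\<^sub>0\<close> includes that it is real, so \<open>M\<close> is Hermitian.\<close>

definition pos_semidef :: "('r \<Rightarrow> nat) \<Rightarrow> 'r set \<Rightarrow> 'r operator \<Rightarrow> bool" where
  "pos_semidef d R M \<longleftrightarrow>
     (\<forall>v :: ('r \<Rightarrow> nat) \<Rightarrow> complex.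
        (\<Sum>x\<in>labels d R. \<Sum>y\<in>labels d R. cnj (v x) * M x y * v y) \<in> \<real>\<^sub>\<ge>\<^sub>0)"

definition is_state :: "('r \<Rightarrow> nat) \<Rightarrow> 'r set \<Rightarrow> 'r operator \<Rightarrow> bool" where
  "is_state d R M \<longleftrightarrow> pos_semidef d R M \<and> trace_op d R M = 1"

text \<open>
  The partial trace over the registers in \<open>R - S\<close>, an operator on the registers \<open>S \<subseteq> R\<close>.
  \<open>labels d {}\<close> has exactly one element, so for \<open>S = {}\<close> this is the scalar \<open>Tr M\<close>.
\<close>

definition reduced_op :: "('r \<Rightarrow> nat) \<Rightarrow> 'r set \<Rightarrow> 'r set \<Rightarrow> 'r operator \<Rightarrow> 'r operator" where
  "reduced_op d R S M =
     (\<lambda>x y. \<Sum>k\<in>labels d (R - S). M (merge S (R - S) (x, k)) (merge S (R - S) (y, k)))"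

text \<open>The tensor product of an operator on \<open>S\<close> and one on \<open>S'\<close>, for disjoint \<open>S\<close> and \<open>S'\<close>.\<close>

definition tensor_op :: "'r set \<Rightarrow> 'r set \<Rightarrow> 'r operator \<Rightarrow> 'r operator \<Rightarrow> 'r operator" where
  "tensor_op S S' M N =
     (\<lambda>x y. M (restrict x S) (restrict y S) * N (restrict x S') (restrict y S'))"

definition extend_op :: "'r set \<Rightarrow> 'r set \<Rightarrow> 'r operator \<Rightarrow> 'r operator" where
  "extend_op R S M = tensor_op S (R - S) M id_op"

text \<open>The copy on the registers \<open>f ` I\<close> of an operator on the registers \<open>I\<close>, for \<open>f\<close> injective on \<open>I\<close>.\<close>

definition place_op :: "('s \<Rightarrow> 'r) \<Rightarrow> 's set \<Rightarrow> 's operator \<Rightarrow> 'r operator" where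
  "place_op f I M = (\<lambda>x y. M (\<lambda>i\<in>I. x (f i)) (\<lambda>i\<in>I. y (f i)))"

text \<open>The action \<open>M \<mapsto> U M U\<^sup>\<dagger>\<close> of a gate \<open>U\<close> that acts on the registers \<open>S \<subseteq> R\<close>.\<close>

definition apply_gate ::
  "('r \<Rightarrow> nat) \<Rightarrow> 'r set \<Rightarrow> 'r set \<Rightarrow> 'r operator \<Rightarrow> 'r operator \<Rightarrow> 'r operator" where
  "apply_gate d R S U M =
     mult_op d R (mult_op d R (extend_op R S U) M) (adjoint_op (extend_op R S U))"

datatype reg = Anc nat | RegB nat | RegC nat

fun circuit_dim :: "(nat \<Rightarrow> nat) \<Rightarrow> reg \<Rightarrow> nat" where
  "circuit_dim d (Anc i) = 2"
| "circuit_dim d (RegB i) = d i"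
| "circuit_dim d (RegC i) = d i"

definition circuit_regs :: "nat \<Rightarrow> reg set" where
  "circuit_regs n = Anc ` {1..n} \<union> RegB ` {1..n} \<union> RegC ` {1..n}"

definition hadamard :: "reg \<Rightarrow> reg operator" where
  "hadamard r = (\<lambda>x y. (if x r = 1 \<and> y r = 1 then -1 else 1) / complex_of_real (sqrt 2))"

text \<open>\<open>|0\<rangle>\<langle>0| \<otimes> I + |1\<rangle>\<langle>1| \<otimes> SWAP\<close> on the registers \<open>Anc i\<close>, \<open>RegB i\<close>, \<open>RegC i\<close>.\<close>

definition cswap :: "nat \<Rightarrow> reg operator" where
  "cswap i = (\<lambda>x y.
     if x (Anc i) = 0 \<and> y (Anc i) = 0 then
       (if x (RegB i) = y (RegB i) \<and> x (RegC i) = y (RegC i) then 1 else 0)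
     else if x (Anc i) = 1 \<and> y (Anc i) = 1 then
       (if x (RegB i) = y (RegC i) \<and> x (RegC i) = y (RegB i) then 1 else 0)
     else 0)"

text \<open>The projector \<open>|z\<rangle>\<langle>z|\<close> on the ancillas.\<close>

definition ancilla_proj :: "nat \<Rightarrow> (nat \<Rightarrow> nat) \<Rightarrow> reg operator" where
  "ancilla_proj n z =
     (\<lambda>x y. if \<forall>i\<in>{1..n}. x (Anc i) = z i \<and> y (Anc i) = z i then 1 else 0)"

definition swap_test_initial :: "nat \<Rightarrow> nat operator \<Rightarrow> nat operator \<Rightarrow> reg operator" where
  "swap_test_initial n \<rho> \<sigma> =
     tensor_op (Anc ` {1..n}) (RegB ` {1..n} \<union> RegC ` {1..n})
       (ancilla_proj n (\<lambda>i. 0))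
       (tensor_op (RegB ` {1..n}) (RegC ` {1..n})
          (place_op RegB {1..n} \<rho>) (place_op RegC {1..n} \<sigma>))"

definition hadamard_layer :: "nat \<Rightarrow> (nat \<Rightarrow> nat) \<Rightarrow> reg operator \<Rightarrow> reg operator" where
  "hadamard_layer n d =
     fold (\<lambda>i. apply_gate (circuit_dim d) (circuit_regs n) {Anc i} (hadamard (Anc i))) [1..<Suc n]"

definition cswap_layer :: "nat \<Rightarrow> (nat \<Rightarrow> nat) \<Rightarrow> reg operator \<Rightarrow> reg operator" where
  "cswap_layer n d =
     fold (\<lambda>i. apply_gate (circuit_dim d) (circuit_regs n) {Anc i, RegB i, RegC i} (cswap i))
       [1..<Suc n]"

definition swap_test_final ::
  "nat \<Rightarrow> (nat \<Rightarrow> nat) \<Rightarrow> nat operator \<Rightarrow> nat operator \<Rightarrow> reg operator" where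
  "swap_test_final n d \<rho> \<sigma> =
     hadamard_layer n d (cswap_layer n d (hadamard_layer n d (swap_test_initial n \<rho> \<sigma>)))"

text \<open>The Born rule. For states \<open>\<rho>\<close> and \<open>\<sigma>\<close> the trace is real, so \<open>Re\<close> only changes the type.\<close>

definition swap_test_prob ::
  "nat \<Rightarrow> (nat \<Rightarrow> nat) \<Rightarrow> nat operator \<Rightarrow> nat operator \<Rightarrow> (nat \<Rightarrow> nat) \<Rightarrow> real" where
  "swap_test_prob n d \<rho> \<sigma> z =
     Re (trace_op (circuit_dim d) (circuit_regs n)
       (mult_op (circuit_dim d) (circuit_regs n)
         (extend_op (circuit_regs n) (Anc ` {1..n}) (ancilla_proj n z))
         (swap_test_final n d \<rho> \<sigma>)))"

definition supp :: "nat \<Rightarrow> (nat \<Rightarrow> nat) \<Rightarrow> nat set" where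
  "supp n z = {i\<in>{1..n}. z i \<noteq> 0}"

end

theory Submission
  imports Defs
begin

text \<open>
  Work with matrix entries. The two Hadamard layers expand an entry of the final operator into a
  double sum over \<open>A, B \<subseteq> [n]\<close> (the row and column ancilla strings) with sign
  \<open>(-1)\<^bsup>|A \<inter> T| + |B \<inter> T|\<^esup>\<close>, and the controlled swaps exchange the labels of
  \<open>RegB i\<close> and \<open>RegC i\<close> for \<open>i \<in> A\<close> in the row and for \<open>i \<in> B\<close> in the column. Taking the trace, a relabelling that undoes the exchange in the
  row shows that the summand depends only on the symmetric difference \<open>S\<close> of \<open>A\<close> and \<open>B\<close>. It
  then equals \<open>Tr(\<rho>\<^sub>S \<sigma>\<^sub>S)\<close>, and each \<open>S\<close> occurs \<open>2\<^sup>n\<close> times.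
\<close>

section \<open>Labels of basis vectors, and Hermiticity of positive semidefinite operators\<close>

lemma finite_labels: "finite R \<Longrightarrow> finite (labels d R)"
  unfolding labels_def by (intro finite_PiE) auto

text \<open>Labels are \<open>undefined\<close> outside \<open>R\<close>, so there they agree
  automatically and the right side may quantify over all registers.\<close>

lemma restrict_labels_eq_iff:
  assumes "x \<in> labels d R" "y \<in> labels d R"
  shows "restrict x (R - S) = restrict y (R - S) \<longleftrightarrow> (\<forall>r. r \<notin> S \<longrightarrow> x r = y r)"
  using assms unfolding labels_def PiE_iff extensional_def restrict_def fun_eq_iff
  by (metis (mono_tags, lifting) DiffD2 DiffI mem_Collect_eq)

text \<open>Polarization: the quadratic form is real at the basis vectors e_x and e_y and at e_x + b
  e_y for b = 1 and b = i, which fixes the imaginary and real parts of the off-diagonal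
  entries.\<close>

lemma pos_semidef_hermitian:
  assumes psd: "pos_semidef d R M" and "finite R"
    and x: "x \<in> labels d R" and y: "y \<in> labels d R"
  shows "cnj (M x y) = M y x"
proof -
  define Q where "Q v = (\<Sum>x\<in>labels d R. \<Sum>y\<in>labels d R. cnj (v x) * M x y * v y)" for v
  have real: "Im (Q v) = 0" for v
    using psd unfolding pos_semidef_def Q_def complex_nonneg_Reals_iff by blast
  have fin: "finite (labels d R)"
    using \<open>finite R\<close> by (rule finite_labels)
  \<comment> \<open>Cuts the form down to a set containing the support of \<open>v\<close>, so that
    each test vector leaves at most four terms.\<close>
  have Q: "Q v = (\<Sum>x\<in>A. \<Sum>y\<in>A. cnj (v x) * M x y * v y)"
    if "A \<subseteq> labels d R" "\<And>w. w \<notin> A \<Longrightarrow> v w = 0" for A v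
    unfolding Q_def using that fin
    by (intro sum.mono_neutral_cong_right) (auto intro!: sum.mono_neutral_cong_right)
  show ?thesis
  proof (cases "x = y")
    case True
    have "Q (\<lambda>w. if w = x then 1 else 0) = M x x"
      using x by (subst Q[of "{x}"]) auto
    with real[of "\<lambda>w. if w = x then 1 else 0"] True show ?thesis
      by (auto simp: complex_eq_iff)
  next
    case False
    have Q2: "Q (\<lambda>w. if w = x then 1 else if w = y then b else 0) =
        M x x + M x y * b + cnj b * M y x + cnj b * M y y * b" for b
      using x y False by (subst Q[of "{x, y}"]) (auto simp: algebra_simps)
    have Q1: "Im (Q (\<lambda>w. if w = c then 1 else 0)) = Im (M c c)" if "c \<in> labels d R" for c
      using that by (subst Q[of "{c}"]) auto
    have d: "Im (M x x) = 0" "Im (M y y) = 0"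
      using Q1[OF x] Q1[OF y] real by auto
    have "Im (M x y) + Im (M y x) = 0"
      using real[of "\<lambda>w. if w = x then 1 else if w = y then 1 else 0"] d
      unfolding Q2 by simp
    \<comment> \<open>For b = i the factors \<open>b\<close> and \<open>cnj b\<close> are i and -i,
      so the imaginary part of the form now shows the real parts of the two entries.\<close>
    moreover have "Re (M x y) - Re (M y x) = 0"
      using real[of "\<lambda>w. if w = x then 1 else if w = y then \<i> else 0"] d
      unfolding Q2 by simp
    ultimately show ?thesis
      by (simp add: complex_eq_iff)
  qed
qed

section \<open>Exchanging labels at a set of registers, and overlaps of reduced operators\<close>

definition mix :: "'r set \<Rightarrow> ('r \<Rightarrow> 'a) \<Rightarrow> ('r \<Rightarrow> 'a) \<Rightarrow> 'r \<Rightarrow> 'a" where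
  "mix S u v = (\<lambda>i. if i \<in> S then v i else u i)"

lemma mix_in_labels:
  "u \<in> labels d R \<Longrightarrow> v \<in> labels d R \<Longrightarrow> mix S u v \<in> labels d R"
  unfolding labels_def mix_def by (auto simp: PiE_iff extensional_def)

text \<open>The pair \<open>(mix S u v, mix S v u)\<close> is \<open>(u, v)\<close> with the entries
  at \<open>S\<close> exchanged. Two exchanges cancel where both act; in particular each one is an
  involution.\<close>

lemma mix_mix: "mix B (mix A u v) (mix A v u) = mix (sym_diff A B) u v"
  unfolding mix_def by auto

lemma mix_sym_diff: "mix B u v = mix (sym_diff A B) (mix A u v) (mix A v u)"
  unfolding mix_def by auto

text \<open>This is the trace of (M tensor N) W, where W swaps the two copies of each register in
  \<open>S\<close>.\<close>

definition swap_overlap ::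
  "('r \<Rightarrow> nat) \<Rightarrow> 'r set \<Rightarrow> 'r operator \<Rightarrow> 'r operator \<Rightarrow> 'r set \<Rightarrow> complex" where
  "swap_overlap d R M N S =
     (\<Sum>(u, v)\<in>labels d R \<times> labels d R. M u (mix S u v) * N v (mix S v u))"

lemma sum_mix_reindex:
  "(\<Sum>(u, v)\<in>labels d R \<times> labels d R. f u v) =
   (\<Sum>(u, v)\<in>labels d R \<times> labels d R. f (mix A u v) (mix A v u))"
  by (rule sum.reindex_bij_witness[where
        i = "\<lambda>(u, v). (mix A u v, mix A v u)" and j = "\<lambda>(u, v). (mix A u v, mix A v u)"])
     (auto simp: mix_mix mix_in_labels, auto simp: mix_def)

text \<open>Reindexing the right side by the exchange at \<open>A\<close> turns the row label
  \<open>u\<close> into \<open>mix A u v\<close>; by \<open>mix_sym_diff\<close> the column label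
  becomes \<open>mix B u v\<close>.\<close>

lemma sum_mix_mix:
  "(\<Sum>(u, v)\<in>labels d R \<times> labels d R.
      M (mix A u v) (mix B u v) * N (mix A v u) (mix B v u)) =
   swap_overlap d R M N (sym_diff A B)"
  unfolding swap_overlap_def
  by (subst (2) sum_mix_reindex[where A = A]) (simp flip: mix_sym_diff)

text \<open>Conjugation interchanges rows and columns. The exchange at \<open>S\<close> then sits in
  the row and the empty one in the column, and their symmetric difference is again
  \<open>S\<close>.\<close>

lemma swap_overlap_real:
  assumes "finite R"
    and M: "\<And>x y. x \<in> labels d R \<Longrightarrow> y \<in> labels d R \<Longrightarrow> cnj (M x y) = M y x"
    and N: "\<And>x y. x \<in> labels d R \<Longrightarrow> y \<in> labels d R \<Longrightarrow> cnj (N x y) = N y x"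
  shows "swap_overlap d R M N S \<in> \<real>"
proof -
  have "cnj (swap_overlap d R M N S) =
      (\<Sum>(u, v)\<in>labels d R \<times> labels d R. M (mix S u v) (mix {} u v) * N (mix S v u) (mix {} v u))"
    unfolding swap_overlap_def cnj_sum
    by (intro sum.cong refl) (auto simp: M N mix_in_labels, simp add: mix_def)
  also have "\<dots> = swap_overlap d R M N S"
    by (subst sum_mix_mix) simp
  finally show ?thesis
    by (simp add: Reals_cnj_iff)
qed

lemma sum_labels_merge:
  assumes "S \<subseteq> R"
  shows "(\<Sum>u\<in>labels d R. f u) =
    (\<Sum>x\<in>labels d S. \<Sum>k\<in>labels d (R - S). f (merge S (R - S) (x, k)))"
proof -
  have restrict: "restrict u (S \<union> R) = u" if "u \<in> labels d R" for u
    using that assms by (auto simp: labels_def PiE_iff extensional_def fun_eq_iff)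
  have "(\<Sum>u\<in>labels d R. f u) =
      (\<Sum>p\<in>labels d S \<times> labels d (R - S). f (merge S (R - S) p))"
    using assms
    by (intro sum.reindex_bij_witness[where
          i = "merge S (R - S)" and j = "\<lambda>u. (restrict u S, restrict u (R - S))"])
       (simp_all add: restrict, auto simp: labels_def merge_def PiE_iff extensional_def fun_eq_iff)
  then show ?thesis
    by (simp add: sum.cartesian_product)
qed

text \<open>The swap trick. Split along \<open>S\<close>, u = (x, l) and v = (k, m) become (k, l)
  and (x, m) under the exchange. Summing over l gives the reduced entry of \<open>M\<close> at x, k,
  and summing over m that of \<open>N\<close> at k, x.\<close>

lemma trace_reduced_op:
  assumes "S \<subseteq> R"
  shows "trace_op d S (mult_op d S (reduced_op d R S M) (reduced_op d R S N)) =
    swap_overlap d R M N S"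
proof -
  let ?m = "\<lambda>x k. merge S (R - S) (x, k)"
  have mix: "mix S (?m x l) (?m k m) = ?m k l" for x l k m
    by (auto simp: mix_def merge_def)
  have "swap_overlap d R M N S =
      (\<Sum>x\<in>labels d S. \<Sum>l\<in>labels d (R - S). \<Sum>k\<in>labels d S. \<Sum>m\<in>labels d (R - S).
        M (?m x l) (?m k l) * N (?m k m) (?m x m))"
    unfolding swap_overlap_def sum.cartesian_product[symmetric] sum_labels_merge[OF assms] mix ..
  also have "\<dots> = (\<Sum>x\<in>labels d S. \<Sum>k\<in>labels d S. \<Sum>l\<in>labels d (R - S). \<Sum>m\<in>labels d (R - S).
        M (?m x l) (?m k l) * N (?m k m) (?m x m))"
    by (intro sum.cong refl sum.swap)
  finally show ?thesis
    unfolding trace_op_def mult_op_def reduced_op_def sum_product ..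
qed

section \<open>Matrix entries after a gate\<close>

lemma apply_gate_eq:
  "apply_gate d R S U M x y =
     (\<Sum>k\<in>labels d R. cnj (extend_op R S U y k) *
        (\<Sum>l\<in>labels d R. extend_op R S U x l * M l k))"
  unfolding apply_gate_def mult_op_def adjoint_op_def by (simp add: mult.commute)

text \<open>The extended gate is the identity off \<open>r\<close>, so only labels that differ from
  \<open>x\<close> at most at \<open>r\<close> contribute. The function \<open>g\<close> allows one
  proof for the row factor (identity) and the column factor (\<open>cnj\<close>).\<close>

lemma sum_extend_op_single:
  fixes g :: "complex \<Rightarrow> complex"
  assumes "g 0 = 0" and "finite R" and r: "r \<in> R" and x: "x \<in> labels d R"
  shows "(\<Sum>k\<in>labels d R. g (extend_op R {r} U x k) * f k) =
    (\<Sum>a<d r. g (U (restrict x {r}) (\<lambda>i\<in>{r}. a)) * f (x(r := a)))"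
proof -
  let ?A = "(\<lambda>a. x(r := a)) ` {..<d r}"
  have sub: "?A \<subseteq> labels d R"
    using x r by (auto simp: labels_def PiE_iff extensional_def)
  have zero: "extend_op R {r} U x k = 0" if "k \<in> labels d R - ?A" for k
  proof -
    have "\<not> (\<forall>s. s \<notin> {r} \<longrightarrow> x s = k s)"
    proof
      assume "\<forall>s. s \<notin> {r} \<longrightarrow> x s = k s"
      then have "k = x(r := k r)"
        by (simp add: fun_eq_iff)
      moreover have "k r < d r"
        using that r by (auto simp: labels_def PiE_iff)
      ultimately show False
        using that by blast
    qed
    then have "restrict x (R - {r}) \<noteq> restrict k (R - {r})"
      using restrict_labels_eq_iff[OF x, of k "{r}"] that by simp
    then show ?thesis
      by (simp add: extend_op_def tensor_op_def id_op_def)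
  qed
  have inj: "inj_on (\<lambda>a. x(r := a)) {..<d r}"
    by (intro inj_onI) (metis fun_upd_same)
  have "(\<Sum>k\<in>labels d R. g (extend_op R {r} U x k) * f k) =
      (\<Sum>k\<in>?A. g (extend_op R {r} U x k) * f k)"
    using sub zero finite_labels[OF \<open>finite R\<close>] \<open>g 0 = 0\<close>
    by (intro sum.mono_neutral_right) auto
  also have "\<dots> = (\<Sum>a<d r. g (extend_op R {r} U x (x(r := a))) * f (x(r := a)))"
    by (simp add: sum.reindex[OF inj])
  also have "\<dots> = (\<Sum>a<d r. g (U (restrict x {r}) (\<lambda>i\<in>{r}. a)) * f (x(r := a)))"
  proof (intro sum.cong refl)
    fix a
    have "restrict (x(r := a)) {r} = (\<lambda>i\<in>{r}. a)" "restrict (x(r := a)) (R - {r}) = restrict x (R - {r})"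
      by auto
    then show "g (extend_op R {r} U x (x(r := a))) * f (x(r := a)) =
        g (U (restrict x {r}) (\<lambda>i\<in>{r}. a)) * f (x(r := a))"
      by (simp add: extend_op_def tensor_op_def id_op_def)
  qed
  finally show ?thesis .
qed

section \<open>Labels of the circuit and their ancilla bits\<close>

lemma finite_circuit_regs: "finite (circuit_regs n)"
  by (simp add: circuit_regs_def)

lemma mem_circuit_regs [simp]:
  "Anc i \<in> circuit_regs n \<longleftrightarrow> i \<in> {1..n}"
  "RegB i \<in> circuit_regs n \<longleftrightarrow> i \<in> {1..n}"
  "RegC i \<in> circuit_regs n \<longleftrightarrow> i \<in> {1..n}"
  by (auto simp: circuit_regs_def)

abbreviation circuit_labels :: "nat \<Rightarrow> (nat \<Rightarrow> nat) \<Rightarrow> (reg \<Rightarrow> nat) set" where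
  "circuit_labels n d \<equiv> labels (circuit_dim d) (circuit_regs n)"

lemma all_reg: "(\<forall>r. P r) \<longleftrightarrow> (\<forall>i. P (Anc i)) \<and> (\<forall>i. P (RegB i)) \<and> (\<forall>i. P (RegC i))"
  by (metis reg.exhaust)

lemma circuit_labels_iff:
  "x \<in> circuit_labels n d \<longleftrightarrow>
    (\<forall>i\<in>{1..n}. x (Anc i) < 2 \<and> x (RegB i) < d i \<and> x (RegC i) < d i) \<and>
    (\<forall>i. i \<notin> {1..n} \<longrightarrow>
      x (Anc i) = undefined \<and> x (RegB i) = undefined \<and> x (RegC i) = undefined)"
proof -
  have "x \<in> circuit_labels n d \<longleftrightarrow>
      (\<forall>r. (r \<in> circuit_regs n \<longrightarrow> x r < circuit_dim d r) \<and>
           (r \<notin> circuit_regs n \<longrightarrow> x r = undefined))"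
    unfolding labels_def PiE_iff extensional_def by auto
  then show ?thesis
    unfolding all_reg by auto
qed

text \<open>Labels are \<open>undefined\<close> at ancillas outside the circuit, so indices outside
  \<open>{1..n}\<close> are uncontrolled here. The layer formulas intersect this set only with
  subsets of \<open>{1..n}\<close>.\<close>

definition ones :: "(reg \<Rightarrow> nat) \<Rightarrow> nat set" where
  "ones x = {i. x (Anc i) = 1}"

text \<open>\<open>J\<close> are the ancillas overwritten, \<open>A \<subseteq> J\<close> those that receive \<open>1\<close>.\<close>

definition set_anc :: "nat set \<Rightarrow> nat set \<Rightarrow> (reg \<Rightarrow> nat) \<Rightarrow> reg \<Rightarrow> nat" where
  "set_anc J A x = (\<lambda>r. case r of
     Anc i \<Rightarrow> if i \<in> J then (if i \<in> A then 1 else 0) else x r | _ \<Rightarrow> x r)"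

lemma set_anc_in_labels:
  assumes "x \<in> circuit_labels n d" "J \<subseteq> {1..n}"
  shows "set_anc J A x \<in> circuit_labels n d"
  using assms unfolding circuit_labels_iff by (auto simp: set_anc_def)

section \<open>The Hadamard layer\<close>

lemma hadamard_entry:
  assumes "x (Anc i) < 2"
  shows "hadamard (Anc i) (restrict x {Anc i}) (\<lambda>r\<in>{Anc i}. 0) = 1 / complex_of_real (sqrt 2)"
    and "hadamard (Anc i) (restrict x {Anc i}) (\<lambda>r\<in>{Anc i}. 1) =
      (-1) ^ card ({i} \<inter> ones x) / complex_of_real (sqrt 2)"
  using assms by (auto simp: hadamard_def ones_def)

text \<open>One term for each choice of the row and column bit; 1/2 is the product of two factors
  1/sqrt 2. Writing the signs with \<open>card ({i} \<inter> ones x)\<close> lets them multiply up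
  to the sign of a set of ancillas.\<close>

lemma apply_hadamard:
  assumes i: "i \<in> {1..n}" and x: "x \<in> circuit_labels n d" and y: "y \<in> circuit_labels n d"
  shows "apply_gate (circuit_dim d) (circuit_regs n) {Anc i} (hadamard (Anc i)) M x y =
    1 / 2 * (M (x(Anc i := 0)) (y(Anc i := 0)) +
      (-1) ^ card ({i} \<inter> ones y) * M (x(Anc i := 0)) (y(Anc i := 1)) +
      (-1) ^ card ({i} \<inter> ones x) * M (x(Anc i := 1)) (y(Anc i := 0)) +
      (-1) ^ card ({i} \<inter> ones x) * (-1) ^ card ({i} \<inter> ones y) *
        M (x(Anc i := 1)) (y(Anc i := 1)))"
proof -
  have lt: "x (Anc i) < 2" "y (Anc i) < 2"
    using i x y by (auto simp: circuit_labels_iff)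
  have sq: "complex_of_real (sqrt 2) * complex_of_real (sqrt 2) = 2"
    by (simp flip: of_real_mult)
  have mem: "Anc i \<in> circuit_regs n"
    using i by simp
  note sums = sum_extend_op_single[where g = "\<lambda>c. c", OF refl finite_circuit_regs mem x]
    sum_extend_op_single[where g = cnj, OF complex_cnj_zero finite_circuit_regs mem y]
  have two: "{..<2::nat} = {0, 1}"
    by auto
  show ?thesis
    unfolding apply_gate_eq
    by (subst sums(1), subst sums(2))
       (simp add: two hadamard_entry[where x = x, OF lt(1), simplified]
          hadamard_entry[where x = y, OF lt(2), simplified] field_simps sq)
qed

lemma sum_Pow_insert:
  assumes "finite J" "j \<notin> J"
  shows "(\<Sum>A\<in>Pow (insert j J). f A) = (\<Sum>A\<in>Pow J. f A + f (insert j A))"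
proof -
  have inj: "inj_on (insert j) (Pow J)"
    using assms by (auto simp: inj_on_def)
  have "(\<Sum>A\<in>Pow (insert j J). f A) = (\<Sum>A\<in>Pow J. f A) + (\<Sum>A\<in>insert j ` Pow J. f A)"
    unfolding Pow_insert using assms by (intro sum.union_disjoint) auto
  then show ?thesis
    by (simp add: sum.reindex[OF inj] sum.distrib)
qed

text \<open>The last gate of the list is outermost, hence the induction from the right. The four
  terms of the gate at \<open>j\<close> correspond to whether \<open>j\<close> belongs to
  \<open>A\<close> and whether it belongs to \<open>B\<close>.\<close>

lemma fold_hadamard:
  assumes "distinct js" "set js \<subseteq> {1..n}"
    and "x \<in> circuit_labels n d" "y \<in> circuit_labels n d"
  shows "fold (\<lambda>i. apply_gate (circuit_dim d) (circuit_regs n) {Anc i} (hadamard (Anc i))) js M x y =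
    1 / 2 ^ length js * (\<Sum>A\<in>Pow (set js). \<Sum>B\<in>Pow (set js).
      (-1) ^ card (A \<inter> ones x) * (-1) ^ card (B \<inter> ones y) *
      M (set_anc (set js) A x) (set_anc (set js) B y))"
  using assms
proof (induction js arbitrary: x y rule: rev_induct)
  case Nil
  have "set_anc {} {} x = x" for x
    by (auto simp: set_anc_def split: reg.split)
  then show ?case
    by simp
next
  case (snoc j js)
  let ?J = "set js"
  have j: "j \<in> {1..n}" "j \<notin> ?J" and fin: "finite ?J"
    using snoc.prems by auto
  have upd: "w(Anc j := 0) \<in> circuit_labels n d" "w(Anc j := 1) \<in> circuit_labels n d"
    if "w \<in> circuit_labels n d" for w
    using that j(1) unfolding circuit_labels_iff by auto
  note IH = snoc.IH[OF _ _ upd(1) upd(1)] snoc.IH[OF _ _ upd(1) upd(2)]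
    snoc.IH[OF _ _ upd(2) upd(1)] snoc.IH[OF _ _ upd(2) upd(2)]
  have ones: "A \<inter> ones (w(Anc j := a)) = A \<inter> ones w" if "A \<in> Pow ?J" for A w a
    using that j by (auto simp: ones_def)
  have set_anc: "set_anc ?J A (w(Anc j := 0)) = set_anc (insert j ?J) A w"
    "set_anc ?J A (w(Anc j := 1)) = set_anc (insert j ?J) (insert j A) w"
    if "A \<in> Pow ?J" for A w
    using that j by (auto simp: set_anc_def fun_eq_iff split: reg.split)
  define s where "s w A = (-1 :: complex) ^ card (A \<inter> ones w)" for w A
  define m where "m A B = M (set_anc (insert j ?J) A x) (set_anc (insert j ?J) B y)" for A B
  define e where "e w = s w {j}" for w
  define c where "c = 1 / (2 :: complex) ^ length js"
  let ?fold = "\<lambda>js. fold (\<lambda>i. apply_gate (circuit_dim d) (circuit_regs n) {Anc i} (hadamard (Anc i))) js M"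
  have s_insert: "s w (insert j A) = e w * s w A" if "A \<in> Pow ?J" for A w
  proof -
    have "finite A" "j \<notin> A"
      using that j fin finite_subset by auto
    then have "card (({j} \<inter> ones w) \<union> (A \<inter> ones w)) = card ({j} \<inter> ones w) + card (A \<inter> ones w)"
      by (intro card_Un_disjoint) auto
    then show ?thesis
      by (simp add: s_def e_def power_add flip: Int_Un_distrib2)
  qed
  have fold_upd:
    "?fold js (x(Anc j := 0)) (y(Anc j := 0)) =
      c * (\<Sum>A\<in>Pow ?J. \<Sum>B\<in>Pow ?J. s x A * s y B * m A B)"
    "?fold js (x(Anc j := 0)) (y(Anc j := 1)) =
      c * (\<Sum>A\<in>Pow ?J. \<Sum>B\<in>Pow ?J. s x A * s y B * m A (insert j B))"
    "?fold js (x(Anc j := 1)) (y(Anc j := 0)) =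
      c * (\<Sum>A\<in>Pow ?J. \<Sum>B\<in>Pow ?J. s x A * s y B * m (insert j A) B)"
    "?fold js (x(Anc j := 1)) (y(Anc j := 1)) =
      c * (\<Sum>A\<in>Pow ?J. \<Sum>B\<in>Pow ?J. s x A * s y B * m (insert j A) (insert j B))"
    using snoc.prems unfolding c_def s_def m_def
    by (simp_all only: IH distinct_append set_append Un_subset_iff)
       (intro arg_cong2[where f = "(*)"] refl sum.cong; simp only: ones set_anc)+
  \<comment> \<open>Linear rearrangement that gathers the four double sums under one, ready for
    \<open>sum_Pow_insert\<close> in both variables.\<close>
  have factor: "h * (c * (\<Sum>A\<in>Pow ?J. \<Sum>B\<in>Pow ?J. f1 A B) + q * (c * (\<Sum>A\<in>Pow ?J. \<Sum>B\<in>Pow ?J. f2 A B)) +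
      p * (c * (\<Sum>A\<in>Pow ?J. \<Sum>B\<in>Pow ?J. f3 A B)) + p * q * (c * (\<Sum>A\<in>Pow ?J. \<Sum>B\<in>Pow ?J. f4 A B))) =
    h * c * (\<Sum>A\<in>Pow ?J. \<Sum>B\<in>Pow ?J. f1 A B + q * f2 A B + (p * f3 A B + p * q * f4 A B))"
    for h p q :: complex and f1 f2 f3 f4
    by (simp only: sum.distrib sum_distrib_left[symmetric]) (simp only: algebra_simps)
  have "?fold (js @ [j]) x y = 1 / 2 * c * (\<Sum>A\<in>Pow ?J. \<Sum>B\<in>Pow ?J.
      s x A * s y B * m A B + e y * (s x A * s y B * m A (insert j B)) +
      (e x * (s x A * s y B * m (insert j A) B) +
       e x * e y * (s x A * s y B * m (insert j A) (insert j B))))"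
    using apply_hadamard[OF j(1) snoc.prems(3,4), of "?fold js"]
    unfolding fold_upd s_def[symmetric] e_def[symmetric] factor by simp
  also have "\<dots> = 1 / 2 * c * (\<Sum>A\<in>Pow ?J. \<Sum>B\<in>Pow ?J.
      s x A * s y B * m A B + s x A * s y (insert j B) * m A (insert j B) +
      (s x (insert j A) * s y B * m (insert j A) B +
       s x (insert j A) * s y (insert j B) * m (insert j A) (insert j B)))"
    by (intro arg_cong2[where f = "(*)"] refl sum.cong) (simp add: s_insert mult_ac)
  also have "\<dots> = 1 / 2 * c * (\<Sum>A\<in>Pow (insert j ?J). \<Sum>B\<in>Pow (insert j ?J). s x A * s y B * m A B)"
    by (simp only: sum_Pow_insert[OF fin j(2)] sum.distrib add_ac)
  finally show ?case
    by (simp add: c_def s_def m_def)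
qed

lemma hadamard_layer_eq:
  assumes "x \<in> circuit_labels n d" "y \<in> circuit_labels n d"
  shows "hadamard_layer n d M x y =
    1 / 2 ^ n * (\<Sum>A\<in>Pow {1..n}. \<Sum>B\<in>Pow {1..n}.
      (-1) ^ card (A \<inter> ones x) * (-1) ^ card (B \<inter> ones y) *
      M (set_anc {1..n} A x) (set_anc {1..n} B y))"
proof -
  have set: "set [1..<Suc n] = {1..n}"
    by auto
  show ?thesis
    unfolding hadamard_layer_def
    using fold_hadamard[of "[1..<Suc n]" n x d y M, unfolded set] assms
    by (simp del: upt_Suc)
qed

section \<open>The controlled-swap layer\<close>

definition swap_regs :: "nat set \<Rightarrow> (reg \<Rightarrow> nat) \<Rightarrow> reg \<Rightarrow> nat" where
  "swap_regs J x = (\<lambda>r. case r of Anc i \<Rightarrow> x r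
     | RegB i \<Rightarrow> if i \<in> J \<and> x (Anc i) = 1 then x (RegC i) else x r
     | RegC i \<Rightarrow> if i \<in> J \<and> x (Anc i) = 1 then x (RegB i) else x r)"

lemma swap_regs_in_labels:
  "x \<in> circuit_labels n d \<Longrightarrow> swap_regs J x \<in> circuit_labels n d"
  unfolding circuit_labels_iff by (auto simp: swap_regs_def)

text \<open>The extended gate is a permutation matrix. The two conditions are compared on three
  groups of registers: those off the triple, the control, and the swapped pair.\<close>

lemma extend_cswap:
  assumes i: "i \<in> {1..n}" and x: "x \<in> circuit_labels n d" and k: "k \<in> circuit_labels n d"
  shows "extend_op (circuit_regs n) {Anc i, RegB i, RegC i} (cswap i) x k =
    (if k = swap_regs {i} x then 1 else 0)"
proof -
  have rest: "restrict x (circuit_regs n - {Anc i, RegB i, RegC i}) =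
      restrict k (circuit_regs n - {Anc i, RegB i, RegC i}) \<longleftrightarrow>
      (\<forall>j. j \<noteq> i \<longrightarrow> x (Anc j) = k (Anc j) \<and> x (RegB j) = k (RegB j) \<and> x (RegC j) = k (RegC j))"
    unfolding restrict_labels_eq_iff[OF x k] all_reg by auto
  have swap: "k = swap_regs {i} x \<longleftrightarrow>
      (\<forall>j. j \<noteq> i \<longrightarrow> x (Anc j) = k (Anc j) \<and> x (RegB j) = k (RegB j) \<and> x (RegC j) = k (RegC j)) \<and>
      k (Anc i) = x (Anc i) \<and>
      (if x (Anc i) = 1 then x (RegB i) = k (RegC i) \<and> x (RegC i) = k (RegB i)
       else x (RegB i) = k (RegB i) \<and> x (RegC i) = k (RegC i))"
    unfolding fun_eq_iff all_reg by (auto simp: swap_regs_def) metis+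
  have "x (Anc i) < 2" "k (Anc i) < 2"
    using i x k by (auto simp: circuit_labels_iff)
  then have "x (Anc i) = 0 \<or> x (Anc i) = 1" "k (Anc i) = 0 \<or> k (Anc i) = 1"
    by auto
  \<comment> \<open>For control bits in {0, 1} the nested cases of \<open>cswap\<close> collapse
    into one condition; this is stated for arbitrary numbers and then instantiated.\<close>
  moreover have "(if a = 0 \<and> a' = 0 then (if b = b' \<and> c = c' then 1 else 0)
      else if a = 1 \<and> a' = 1 then (if b = c' \<and> c = b' then 1 else 0) else (0 :: complex)) =
    (if a' = a \<and> (if a = 1 then b = c' \<and> c = b' else b = b' \<and> c = c') then 1 else 0)"
    if "a = 0 \<or> a = 1" "a' = 0 \<or> a' = 1" for a a' b b' c c' :: nat
    using that by (elim disjE) simp_all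
  ultimately have entry: "cswap i (restrict x {Anc i, RegB i, RegC i}) (restrict k {Anc i, RegB i, RegC i}) =
      (if k (Anc i) = x (Anc i) \<and>
        (if x (Anc i) = 1 then x (RegB i) = k (RegC i) \<and> x (RegC i) = k (RegB i)
         else x (RegB i) = k (RegB i) \<and> x (RegC i) = k (RegC i)) then 1 else 0)"
    by (simp only: cswap_def restrict_apply insert_iff simp_thms if_True)
  have conj: "(if a then 1 else 0) * (if b then 1 else 0) = (if b \<and> a then 1 else (0 :: complex))" for a b
    by simp
  show ?thesis
    unfolding extend_op_def tensor_op_def id_op_def rest swap entry by (rule conj)
qed

text \<open>Conjugation by a permutation matrix relabels rows and columns; its entries are real, so
  the adjoint brings no conjugation.\<close>

lemma apply_cswap:
  assumes i: "i \<in> {1..n}" and x: "x \<in> circuit_labels n d" and y: "y \<in> circuit_labels n d"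
  shows "apply_gate (circuit_dim d) (circuit_regs n) {Anc i, RegB i, RegC i} (cswap i) M x y =
    M (swap_regs {i} x) (swap_regs {i} y)"
proof -
  have "(\<Sum>k\<in>circuit_labels n d. extend_op (circuit_regs n) {Anc i, RegB i, RegC i} (cswap i) x k * f k) =
      f (swap_regs {i} x)"
    if x: "x \<in> circuit_labels n d" for f x
    using swap_regs_in_labels[OF x] finite_labels[OF finite_circuit_regs]
    by (simp add: extend_cswap[OF i x] if_distrib[where f = "\<lambda>c. c * _"] cong: if_cong)
  moreover have "cnj (extend_op (circuit_regs n) {Anc i, RegB i, RegC i} (cswap i) y k) =
      extend_op (circuit_regs n) {Anc i, RegB i, RegC i} (cswap i) y k" if "k \<in> circuit_labels n d" for k
    by (simp add: extend_cswap[OF i y that])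
  ultimately show ?thesis
    unfolding apply_gate_eq using x y by (simp cong: sum.cong)
qed

text \<open>Swaps at different indices touch disjoint data registers and leave all controls
  unchanged, so they combine. Distinctness excludes a repeated swap, which would undo
  itself.\<close>

lemma fold_cswap:
  assumes "distinct js" "set js \<subseteq> {1..n}"
    and "x \<in> circuit_labels n d" "y \<in> circuit_labels n d"
  shows "fold (\<lambda>i. apply_gate (circuit_dim d) (circuit_regs n) {Anc i, RegB i, RegC i} (cswap i))
      js M x y = M (swap_regs (set js) x) (swap_regs (set js) y)"
  using assms
proof (induction js arbitrary: x y rule: rev_induct)
  case Nil
  have "swap_regs {} x = x" for x
    by (auto simp: swap_regs_def split: reg.split)
  then show ?case
    by simp
next
  case (snoc j js)
  have "swap_regs (set js) (swap_regs {j} w) = swap_regs (insert j (set js)) w" for w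
    using snoc.prems(1) by (auto simp: swap_regs_def fun_eq_iff split: reg.split)
  then show ?case
    using snoc.prems by (simp add: apply_cswap snoc.IH swap_regs_in_labels)
qed

lemma cswap_layer_eq:
  assumes "x \<in> circuit_labels n d" "y \<in> circuit_labels n d"
  shows "cswap_layer n d M x y = M (swap_regs {1..n} x) (swap_regs {1..n} y)"
proof -
  have set: "set [1..<Suc n] = {1..n}"
    by auto
  show ?thesis
    unfolding cswap_layer_def
    using fold_cswap[of "[1..<Suc n]" n x d y M, unfolded set] assms
    by (simp del: upt_Suc)
qed

section \<open>The operator before the measurement\<close>

definition input_op :: "nat \<Rightarrow> nat operator \<Rightarrow> nat operator \<Rightarrow> reg operator" where
  "input_op n \<rho> \<sigma> = (\<lambda>x y. place_op RegB {1..n} \<rho> x y * place_op RegC {1..n} \<sigma> x y)"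

text \<open>All ancillas start in 0, so only the empty sets survive. \<open>input_op\<close> reads
  data registers alone, so the overwritten ancillas disappear from it.\<close>

lemma swap_test_initial_set_anc:
  assumes "A \<subseteq> {1..n}" "B \<subseteq> {1..n}"
  shows "swap_test_initial n \<rho> \<sigma> (set_anc {1..n} A x) (set_anc {1..n} B y) =
    (if A = {} \<and> B = {} then input_op n \<rho> \<sigma> x y else 0)"
proof -
  have "(\<forall>i\<in>{1..n}. set_anc {1..n} A x (Anc i) = 0 \<and> set_anc {1..n} B y (Anc i) = 0) \<longleftrightarrow>
      A = {} \<and> B = {}"
    using assms by (auto simp: set_anc_def split: if_splits)
  then have "ancilla_proj n (\<lambda>i. 0) (restrict (set_anc {1..n} A x) (Anc ` {1..n}))
      (restrict (set_anc {1..n} B y) (Anc ` {1..n})) = (if A = {} \<and> B = {} then 1 else 0)"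
    unfolding ancilla_proj_def by auto
  moreover have "tensor_op (RegB ` {1..n}) (RegC ` {1..n}) (place_op RegB {1..n} \<rho>) (place_op RegC {1..n} \<sigma>)
      (restrict (set_anc {1..n} A x) (RegB ` {1..n} \<union> RegC ` {1..n}))
      (restrict (set_anc {1..n} B y) (RegB ` {1..n} \<union> RegC ` {1..n})) = input_op n \<rho> \<sigma> x y"
    unfolding tensor_op_def place_op_def input_op_def set_anc_def
    by (intro arg_cong2[where f = "(*)"] arg_cong2[where f = \<rho>] arg_cong2[where f = \<sigma>]) auto
  ultimately show ?thesis
    unfolding swap_test_initial_def tensor_op_def[of "Anc ` {1..n}"] by simp
qed

text \<open>The ancillas are now in the uniform superposition: the entry does not depend on the
  ancilla bits of \<open>x\<close> and \<open>y\<close>.\<close>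

lemma hadamard_layer_initial:
  assumes "x \<in> circuit_labels n d" "y \<in> circuit_labels n d"
  shows "hadamard_layer n d (swap_test_initial n \<rho> \<sigma>) x y = 1 / 2 ^ n * input_op n \<rho> \<sigma> x y"
proof -
  have "(\<Sum>A\<in>Pow {1..n}. \<Sum>B\<in>Pow {1..n}. (-1) ^ card (A \<inter> ones x) * (-1) ^ card (B \<inter> ones y) *
      swap_test_initial n \<rho> \<sigma> (set_anc {1..n} A x) (set_anc {1..n} B y)) =
    (\<Sum>A\<in>Pow {1..n}. \<Sum>B\<in>Pow {1..n}.
      if A = {} then if B = {} then input_op n \<rho> \<sigma> x y else 0 else 0)"
    by (intro sum.cong refl) (auto simp: swap_test_initial_set_anc simp del: One_nat_def)
  also have "\<dots> = (\<Sum>A\<in>Pow {1..n}. if A = {} then input_op n \<rho> \<sigma> x y else 0)"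
    by (intro sum.cong refl) auto
  also have "\<dots> = input_op n \<rho> \<sigma> x y"
    by simp
  finally show ?thesis
    unfolding hadamard_layer_eq[OF assms] by simp
qed

text \<open>The sum comes from the second Hadamard layer, with \<open>A\<close> and \<open>B\<close>
  the ancilla strings before it. Each of the two layers contributes a factor 1/2^n.\<close>

lemma swap_test_final_eq:
  assumes "x \<in> circuit_labels n d" "y \<in> circuit_labels n d"
  shows "swap_test_final n d \<rho> \<sigma> x y = 1 / 4 ^ n * (\<Sum>A\<in>Pow {1..n}. \<Sum>B\<in>Pow {1..n}.
      (-1) ^ card (A \<inter> ones x) * (-1) ^ card (B \<inter> ones y) *
      input_op n \<rho> \<sigma> (swap_regs {1..n} (set_anc {1..n} A x)) (swap_regs {1..n} (set_anc {1..n} B y)))"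
proof -
  let ?M = "cswap_layer n d (hadamard_layer n d (swap_test_initial n \<rho> \<sigma>))"
  have M: "?M (set_anc {1..n} A x) (set_anc {1..n} B y) = 1 / 2 ^ n *
      input_op n \<rho> \<sigma> (swap_regs {1..n} (set_anc {1..n} A x)) (swap_regs {1..n} (set_anc {1..n} B y))"
    for A B
    using assms
    by (simp add: cswap_layer_eq hadamard_layer_initial set_anc_in_labels swap_regs_in_labels
        del: One_nat_def)
  have "(4 :: complex) ^ n = 2 ^ n * 2 ^ n"
    by (simp flip: power_mult_distrib)
  then show ?thesis
    unfolding swap_test_final_def hadamard_layer_eq[OF assms, of ?M] M
    by (simp add: sum_distrib_left mult_ac flip: sum_divide_distrib)
qed

section \<open>The measurement, as a sum over data labels\<close>

lemma trace_ancilla_proj: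
  "trace_op (circuit_dim d) (circuit_regs n) (mult_op (circuit_dim d) (circuit_regs n)
     (extend_op (circuit_regs n) (Anc ` {1..n}) (ancilla_proj n z)) M) =
   (\<Sum>x | x \<in> circuit_labels n d \<and> (\<forall>i\<in>{1..n}. x (Anc i) = z i). M x x)"
proof -
  \<comment> \<open>The extended projector is diagonal and selects the labels whose ancilla string
    is \<open>z\<close>.\<close>
  have E: "extend_op (circuit_regs n) (Anc ` {1..n}) (ancilla_proj n z) x k =
      (if k = x then if \<forall>i\<in>{1..n}. x (Anc i) = z i then 1 else 0 else 0)"
    if "x \<in> circuit_labels n d" "k \<in> circuit_labels n d" for x k
  proof -
    have anc: "x (Anc i) = k (Anc i)" if "i \<notin> {1..n}" for i
      using that \<open>x \<in> _\<close> \<open>k \<in> _\<close> unfolding circuit_labels_iff by simp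
    have "restrict x (circuit_regs n - Anc ` {1..n}) = restrict k (circuit_regs n - Anc ` {1..n}) \<longleftrightarrow>
        (\<forall>i. x (RegB i) = k (RegB i) \<and> x (RegC i) = k (RegC i))"
      unfolding restrict_labels_eq_iff[OF that] all_reg using anc by blast
    moreover have "k = x \<longleftrightarrow> (\<forall>i\<in>{1..n}. x (Anc i) = k (Anc i)) \<and>
        (\<forall>i. x (RegB i) = k (RegB i) \<and> x (RegC i) = k (RegC i))"
      unfolding fun_eq_iff all_reg using anc by metis
    ultimately show ?thesis
      unfolding extend_op_def tensor_op_def id_op_def ancilla_proj_def by auto
  qed
  have "trace_op (circuit_dim d) (circuit_regs n) (mult_op (circuit_dim d) (circuit_regs n)
     (extend_op (circuit_regs n) (Anc ` {1..n}) (ancilla_proj n z)) M) =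
    (\<Sum>x\<in>circuit_labels n d. if \<forall>i\<in>{1..n}. x (Anc i) = z i then M x x else 0)"
    unfolding trace_op_def mult_op_def
  proof (intro sum.cong refl)
    fix x assume x: "x \<in> circuit_labels n d"
    have "(\<Sum>k\<in>circuit_labels n d.
        extend_op (circuit_regs n) (Anc ` {1..n}) (ancilla_proj n z) x k * M k x) =
      (\<Sum>k\<in>circuit_labels n d.
        if k = x then if \<forall>i\<in>{1..n}. x (Anc i) = z i then M k x else 0 else 0)"
      by (intro sum.cong refl) (auto simp: E[OF x] simp del: One_nat_def)
    then show "(\<Sum>k\<in>circuit_labels n d.
        extend_op (circuit_regs n) (Anc ` {1..n}) (ancilla_proj n z) x k * M k x) =
      (if \<forall>i\<in>{1..n}. x (Anc i) = z i then M x x else 0)"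
      using x finite_labels[OF finite_circuit_regs] by simp
  qed
  then show ?thesis
    by (simp add: sum.inter_filter[OF finite_labels[OF finite_circuit_regs]])
qed

text \<open>With the ancilla string fixed, a label amounts to its two data parts. As
  \<open>z\<close> is \<open>undefined\<close> outside \<open>{1..n}\<close>,
  \<open>case_reg z u v\<close> is again a circuit label.\<close>

lemma sum_circuit_labels:
  assumes z: "z \<in> {1..n} \<rightarrow>\<^sub>E {0, 1}"
  shows "(\<Sum>x | x \<in> circuit_labels n d \<and> (\<forall>i\<in>{1..n}. x (Anc i) = z i). f x) =
    (\<Sum>(u, v)\<in>labels d {1..n} \<times> labels d {1..n}. f (case_reg z u v))"
proof (rule sum.reindex_bij_witness[where
      i = "\<lambda>(u, v). case_reg z u v" and
      j = "\<lambda>x. (\<lambda>i. x (RegB i), \<lambda>i. x (RegC i))"])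
  fix x assume "x \<in> {x. x \<in> circuit_labels n d \<and> (\<forall>i\<in>{1..n}. x (Anc i) = z i)}"
  then have x: "x \<in> circuit_labels n d" and "\<forall>i\<in>{1..n}. x (Anc i) = z i"
    by auto
  with z have "x (Anc i) = z i" for i
    by (cases "i \<in> {1..n}") (auto simp: circuit_labels_iff PiE_iff extensional_def)
  then have eq: "case_reg z (\<lambda>i. x (RegB i)) (\<lambda>i. x (RegC i)) = x"
    by (auto simp: fun_eq_iff split: reg.split)
  then show "(case (\<lambda>i. x (RegB i), \<lambda>i. x (RegC i)) of (u, v) \<Rightarrow> case_reg z u v) = x"
    by simp
  show "(case (\<lambda>i. x (RegB i), \<lambda>i. x (RegC i)) of (u, v) \<Rightarrow> f (case_reg z u v)) = f x"
    by (simp add: eq)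
  show "(\<lambda>i. x (RegB i), \<lambda>i. x (RegC i)) \<in> labels d {1..n} \<times> labels d {1..n}"
    using x unfolding circuit_labels_iff by (auto simp: labels_def PiE_iff extensional_def)
next
  fix p assume "p \<in> labels d {1..n} \<times> labels d {1..n}"
  then obtain u v where p: "p = (u, v)" "u \<in> labels d {1..n}" "v \<in> labels d {1..n}"
    by auto
  have "z i < 2" if "i \<in> {1..n}" for i
    using PiE_mem[OF z that] by auto
  with z p show "(case p of (u, v) \<Rightarrow> case_reg z u v) \<in>
      {x. x \<in> circuit_labels n d \<and> (\<forall>i\<in>{1..n}. x (Anc i) = z i)}"
    unfolding circuit_labels_iff by (auto simp: labels_def PiE_iff extensional_def)
qed auto

text \<open>After overwriting, the controls equal to 1 within \<open>{1..n}\<close> are exactly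
  \<open>A\<close> in the row and \<open>B\<close> in the column, so the controlled swaps act as
  exchanges at these sets.\<close>

lemma input_op_swap_regs:
  assumes "u \<in> labels d {1..n}" "v \<in> labels d {1..n}"
    and "A \<subseteq> {1..n}" "B \<subseteq> {1..n}"
  shows "input_op n \<rho> \<sigma> (swap_regs {1..n} (set_anc {1..n} A (case_reg z u v)))
      (swap_regs {1..n} (set_anc {1..n} B (case_reg z u v))) =
    \<rho> (mix A u v) (mix B u v) * \<sigma> (mix A v u) (mix B v u)"
  unfolding input_op_def place_op_def using assms
  by (intro arg_cong2[where f = "(*)"] arg_cong2[where f = \<rho>] arg_cong2[where f = \<sigma>])
     (auto simp: swap_regs_def set_anc_def mix_def labels_def PiE_iff extensional_def fun_eq_iff)

section \<open>Signs and sums over symmetric differences\<close>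

lemma minus_one_card_sym_diff:
  assumes "finite A" "finite B"
  shows "(-1 :: 'a :: comm_ring_1) ^ card (sym_diff A B \<inter> T) =
    (-1) ^ card (A \<inter> T) * (-1) ^ card (B \<inter> T)"
proof -
  have split: "card (X \<inter> T) = card ((X - Y) \<inter> T) + card (X \<inter> Y \<inter> T)" if "finite X" for X Y :: "'b set"
    using that by (subst card_Un_disjoint[symmetric]) (auto intro!: arg_cong[where f = card])
  have "card (sym_diff A B \<inter> T) = card ((A - B) \<inter> T) + card ((B - A) \<inter> T)"
    using assms by (subst card_Un_disjoint[symmetric]) (auto intro!: arg_cong[where f = card])
  \<comment> \<open>Indices common to \<open>A\<close>, \<open>B\<close> and \<open>T\<close> are
    counted twice in the product of signs and cancel.\<close>
  moreover have "(-1 :: 'a) ^ card (A \<inter> B \<inter> T) * (-1) ^ card (A \<inter> B \<inter> T) = 1"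
    by (simp flip: power_mult_distrib)
  ultimately show ?thesis
    using split[OF assms(1), of B] split[OF assms(2), of A]
    by (simp add: power_add Int_commute[of B A] mult_ac)
qed

text \<open>For fixed \<open>A\<close>, symmetric difference with \<open>A\<close> is an involution
  of the power set, so every inner sum equals the full sum over \<open>S\<close>.\<close>

lemma sum_Pow_sym_diff:
  assumes "finite I"
  shows "(\<Sum>A\<in>Pow I. \<Sum>B\<in>Pow I. f (sym_diff A B)) = of_nat (2 ^ card I) * (\<Sum>S\<in>Pow I. f S)"
proof -
  have "(\<Sum>B\<in>Pow I. f (sym_diff A B)) = (\<Sum>S\<in>Pow I. f S)" if "A \<in> Pow I" for A
    using that
    by (intro sum.reindex_bij_witness[where i = "sym_diff A" and j = "sym_diff A"]) auto
  then show ?thesis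
    by (simp add: card_Pow[OF assms])
qed

section \<open>The outcome probability\<close>

theorem proposition6:
  fixes n :: nat and d :: "nat \<Rightarrow> nat" and \<rho> \<sigma> :: "nat operator" and z :: "nat \<Rightarrow> nat"
  assumes "is_state d {1..n} \<rho>"
    and "is_state d {1..n} \<sigma>"
    and "z \<in> {1..n} \<rightarrow>\<^sub>E {0, 1}"
  shows "complex_of_real (swap_test_prob n d \<rho> \<sigma> z) =
    1 / 2 ^ n * (\<Sum>S\<in>Pow {1..n}. (-1) ^ card (S \<inter> supp n z) *
      trace_op d S (mult_op d S (reduced_op d {1..n} S \<rho>) (reduced_op d {1..n} S \<sigma>)))"
proof -
  let ?I = "{1..n}" and ?T = "supp n z"
  let ?L = "labels d ?I"
  let ?t = "\<Sum>x | x \<in> circuit_labels n d \<and> (\<forall>i\<in>?I. x (Anc i) = z i). swap_test_final n d \<rho> \<sigma> x x"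
  let ?rhs = "1 / 2 ^ n * (\<Sum>S\<in>Pow ?I. (-1) ^ card (S \<inter> ?T) * swap_overlap d ?I \<rho> \<sigma> S)"
  have ones: "A \<inter> ones x = A \<inter> ?T" if "\<forall>i\<in>?I. x (Anc i) = z i" "A \<in> Pow ?I" for A x
    using that PiE_mem[OF assms(3)] by (fastforce simp: ones_def supp_def)
  \<comment> \<open>On the diagonal, row and column carry the same ancilla string \<open>z\<close>,
    so both signs refer to \<open>?T\<close> and merge into that of the symmetric
    difference.\<close>
  have "?t = (\<Sum>x | x \<in> circuit_labels n d \<and> (\<forall>i\<in>?I. x (Anc i) = z i).
      1 / 4 ^ n * (\<Sum>A\<in>Pow ?I. \<Sum>B\<in>Pow ?I. (-1) ^ card (sym_diff A B \<inter> ?T) *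
        input_op n \<rho> \<sigma> (swap_regs ?I (set_anc ?I A x)) (swap_regs ?I (set_anc ?I B x))))"
  proof (intro sum.cong refl, goal_cases)
    case (1 x)
    then have x: "x \<in> circuit_labels n d" and *: "\<forall>i\<in>?I. x (Anc i) = z i"
      by auto
    have sign: "(-1 :: complex) ^ card (A \<inter> ones x) * (-1) ^ card (B \<inter> ones x) =
        (-1) ^ card (sym_diff A B \<inter> ?T)" if "A \<in> Pow ?I" "B \<in> Pow ?I" for A B
    proof -
      have "finite A" "finite B"
        using that finite_subset by auto
      then show ?thesis
        by (simp only: ones[OF *] that minus_one_card_sym_diff)
    qed
    show ?case
      unfolding swap_test_final_eq[OF x x]
      by (intro arg_cong2[where f = "(*)"] sum.cong refl) (rule sign; assumption)
  qed
  also have "\<dots> = (\<Sum>(u, v)\<in>?L \<times> ?L.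
      1 / 4 ^ n * (\<Sum>A\<in>Pow ?I. \<Sum>B\<in>Pow ?I. (-1) ^ card (sym_diff A B \<inter> ?T) *
        (\<rho> (mix A u v) (mix B u v) * \<sigma> (mix A v u) (mix B v u))))"
    unfolding sum_circuit_labels[OF assms(3)]
  proof (intro sum.cong refl, goal_cases)
    case (1 p)
    then obtain u v where p: "p = (u, v)" "u \<in> ?L" "v \<in> ?L"
      by auto
    show ?case
      unfolding p(1) prod.case
      by (intro arg_cong2[where f = "(*)"] sum.cong refl)
         (simp only: input_op_swap_regs[OF p(2,3)] Pow_iff)
  qed
  \<comment> \<open>Moves the sum over labels inward, first past \<open>A\<close> and then past
    \<open>B\<close>.\<close>
  also have "\<dots> = 1 / 4 ^ n * (\<Sum>A\<in>Pow ?I. \<Sum>B\<in>Pow ?I. (-1) ^ card (sym_diff A B \<inter> ?T) *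
      (\<Sum>(u, v)\<in>?L \<times> ?L. \<rho> (mix A u v) (mix B u v) * \<sigma> (mix A v u) (mix B v u)))"
    unfolding case_prod_unfold sum_distrib_left
    by (subst sum.swap, rule sum.cong[OF refl], rule sum.swap)
  \<comment> \<open>By \<open>sum_mix_mix\<close> the inner sum depends only on the symmetric
    difference, and each set arises from 2^n pairs.\<close>
  also have "\<dots> = 1 / 4 ^ n * (2 ^ n * (\<Sum>S\<in>Pow ?I. (-1) ^ card (S \<inter> ?T) * swap_overlap d ?I \<rho> \<sigma> S))"
    unfolding sum_mix_mix
    by (subst sum_Pow_sym_diff[where f = "\<lambda>S. (-1) ^ card (S \<inter> ?T) * swap_overlap d ?I \<rho> \<sigma> S"])
       simp_all
  also have "\<dots> = ?rhs"
  proof -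
    have "(4 :: complex) ^ n = 2 ^ n * 2 ^ n"
      by (simp flip: power_mult_distrib)
    then show ?thesis
      by simp
  qed
  finally have t: "?t = ?rhs" .
  \<comment> \<open>The probability is defined through \<open>Re\<close>, so the complex equation
    also requires the right side to be real. This follows from Hermiticity of the two
    states.\<close>
  have psd: "pos_semidef d ?I \<rho>" "pos_semidef d ?I \<sigma>"
    using assms(1,2) unfolding is_state_def by auto
  note hermitian = pos_semidef_hermitian[OF psd(1) finite_atLeastAtMost]
    pos_semidef_hermitian[OF psd(2) finite_atLeastAtMost]
  have "swap_overlap d ?I \<rho> \<sigma> S \<in> \<real>" for S
    by (rule swap_overlap_real[OF finite_atLeastAtMost hermitian])
  then have "(\<Sum>S\<in>Pow ?I. (-1) ^ card (S \<inter> ?T) * swap_overlap d ?I \<rho> \<sigma> S) \<in> \<real>"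
    by (intro sum_in_Reals Reals_mult) simp_all
  then have "?rhs \<in> \<real>"
    by (intro Reals_mult) simp_all
  then have "complex_of_real (swap_test_prob n d \<rho> \<sigma> z) = ?rhs"
    unfolding swap_test_prob_def trace_ancilla_proj t by (rule of_real_Re)
  also have "\<dots> = 1 / 2 ^ n * (\<Sum>S\<in>Pow ?I. (-1) ^ card (S \<inter> ?T) *
      trace_op d S (mult_op d S (reduced_op d ?I S \<rho>) (reduced_op d ?I S \<sigma>)))"
    by (intro arg_cong2[where f = "(*)"] sum.cong refl) (simp only: trace_reduced_op Pow_iff)
  finally show ?thesis .
qed

end
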